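(* Let $n\ge 1$ be an integer and let $S_n=X_1+\cdots+X_n$, where $X_1,\dots,X_n$ are independent symmetric real random variables with $|X_i|\le 1$ for all $i$. Then for every real $x>0$, $$\mathbb{P}\{S_n\ge x\}\le \begin{cases}\mathbb{P}\{W_n\ge x\}, & \text{if } \lceil x\rceil+n \text{ is even},\\ \mathbb{P}\{W_{n-1}\ge x\}, & \text{if } \lceil x\rceil+n \text{ is odd}.\end{cases}$$
   Context: A random variable $X$ is symmetric if $X$ and $-X$ have the same distribution. For an integer $m\ge 0$, $W_m=\varepsilon_1+\cdots+\varepsilon_m$ denotes a sum of $m$ independent Rademacher random variables, i.e. $\mathbb{P}\{\varepsilon_i=1\}=\mathbb{P}\{\varepsilon_i=-1\}=1/2$; in particular $W_0=0$. $\lceil x\rceil$ is the least integer that is at least $x$. *)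

theory Defs
  imports "HOL-Probability.Probability"
begin

definition symmetric_rv :: "'a measure \<Rightarrow> ('a \<Rightarrow> real) \<Rightarrow> bool" where
  "symmetric_rv M X \<longleftrightarrow>
     X \<in> borel_measurable M \<and> distr M borel X = distr M borel (\<lambda>\<omega>. - X \<omega>)"

definition rademacher_pmf :: "real pmf" where
  "rademacher_pmf = pmf_of_set {-1, 1}"

(* Only the law of W_m matters, so W_m is given as a distribution: the image under summation
   of the product of m Rademacher laws. The 0 passed to Pi_pmf is its default value at indices
   outside {1..m}; it does not enter the sum. *)
definition rademacher_sum_pmf :: "nat \<Rightarrow> real pmf" where
  "rademacher_sum_pmf m =
     map_pmf (\<lambda>\<epsilon>. \<Sum>i=1..m. \<epsilon> i) (Pi_pmf {1..m} 0 (\<lambda>_. rademacher_pmf))"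

lemma pmf_rademacher:
  "pmf rademacher_pmf 1 = 1/2" "pmf rademacher_pmf (-1) = 1/2"
  by (simp_all add: rademacher_pmf_def)

lemma rademacher_sum_pmf_0: "rademacher_sum_pmf 0 = return_pmf 0"
  by (simp add: rademacher_sum_pmf_def)

end

theory Submission
  imports Defs
begin

text \<open>
  Flipping the sign of any of the \<open>X i\<close> leaves their joint law unchanged, so
  \<open>\<P>(S\<^sub>n \<ge> x)\<close> is the average over all sign patterns \<open>e\<close> of \<open>\<P>(\<Sum>i. X i * e i \<ge> x)\<close>.
  Exchanging the average with the expectation, it is the mean of the tail of a Rademacher sum
  with the coefficients \<open>X i \<omega> \<in> [-1, 1]\<close>. It therefore suffices to bound this tail for fixed
  coefficients (\<open>rademacher_tail_le_bound\<close>).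

  For fixed coefficients, let \<open>k = \<lceil>x\<rceil>\<close>. If \<open>k = 1\<close>, the bound is \<open>1/2\<close>: a symmetric variable is
  positive with probability at most \<open>1/2\<close>, and the walk with an odd number of steps, which never
  visits 0, attains this. If \<open>k \<ge> 2\<close> and some coefficient is nonzero, multiply the coefficients and the
  threshold by the same factor so that the largest modulus becomes 1; this can only raise the threshold. Conditioning on
  the sign of a coefficient of modulus 1 moves the threshold by exactly 1 in either direction, so
  by induction the tail is at most the average of the bounds for one variable fewer with \<open>k - 1\<close>
  and \<open>k + 1\<close>. These have the same parity case, and the average is the bound itself by the
  recursion of the simple random walk.
\<close>

section \<open>Tails of weighted Rademacher sums\<close>

definition rademacher_tail :: "'i set \<Rightarrow> ('i \<Rightarrow> real) \<Rightarrow> real \<Rightarrow> real" where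
  "rademacher_tail A a x =
     measure_pmf.prob (Pi_pmf A 0 (\<lambda>_. rademacher_pmf)) {e. x \<le> (\<Sum>i\<in>A. a i * e i)}"

lemma rademacher_tail_empty: "rademacher_tail {} a x = (if x \<le> 0 then 1 else 0)"
  by (simp add: rademacher_tail_def)

lemma prob_bind_rademacher:
  "measure_pmf.prob (bind_pmf rademacher_pmf f) S =
     (measure_pmf.prob (f 1) S + measure_pmf.prob (f (-1)) S) / 2"
proof -
  have "ennreal (measure_pmf.prob (bind_pmf rademacher_pmf f) S) =
      (\<integral>\<^sup>+y. emeasure (f y) S \<partial>measure_pmf rademacher_pmf)"
    by (simp add: measure_pmf.emeasure_eq_measure[symmetric] emeasure_bind_pmf)
  also have "\<dots> = ennreal ((measure_pmf.prob (f 1) S + measure_pmf.prob (f (-1)) S) / 2)"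
    by (simp add: rademacher_pmf_def nn_integral_pmf_of_set measure_pmf.emeasure_eq_measure
        ennreal_plus[symmetric] divide_ennreal add.commute del: ennreal_plus
        flip: ennreal_numeral)
  finally show ?thesis
    by (simp add: add_nonneg_nonneg)
qed

text \<open>Conditioning on one sign turns the tail into a two-point average; together with the value
  on the empty index set, this recursion determines all the tails.\<close>
lemma rademacher_tail_insert:
  assumes "finite A" "j \<notin> A"
  shows "rademacher_tail (insert j A) a x =
    (rademacher_tail A a (x - a j) + rademacher_tail A a (x + a j)) / 2"
proof -
  have sum_upd: "(\<Sum>i\<in>insert j A. a i * (f(j := y)) i) = a j * y + (\<Sum>i\<in>A. a i * f i)" for f y
  proof -
    have "(\<Sum>i\<in>A. a i * (f(j := y)) i) = (\<Sum>i\<in>A. a i * f i)"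
      using assms by (intro sum.cong) auto
    then show ?thesis using assms by simp
  qed
  have "(\<lambda>f. f(j := y)) -` {e. x \<le> (\<Sum>i\<in>insert j A. a i * e i)} =
      {e. x - a j * y \<le> (\<Sum>i\<in>A. a i * e i)}" for y
    unfolding vimage_def mem_Collect_eq sum_upd by (auto simp: algebra_simps)
  then show ?thesis
    unfolding rademacher_tail_def Pi_pmf_insert'[OF assms] prob_bind_rademacher
    by (simp flip: map_pmf_def)
qed

lemma rademacher_tail_scale:
  assumes "c > 0"
  shows "rademacher_tail A (\<lambda>i. c * a i) (c * x) = rademacher_tail A a x"
  using assms by (simp add: rademacher_tail_def mult.assoc flip: sum_distrib_left)

text \<open>By symmetry, the second tail is the probability of a value at most \<open>- y\<close>, and \<open>- y < x\<close> makes
  the two events disjoint.\<close>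
lemma rademacher_tail_add_le_1:
  assumes "finite A" "x + y > 0"
  shows "rademacher_tail A a x + rademacher_tail A a y \<le> 1"
  using assms
proof (induction A arbitrary: x y rule: finite_induct)
  case empty
  then show ?case by (auto simp: rademacher_tail_empty)
next
  case (insert j A)
  from insert.IH[of "x - a j" "y + a j"] insert.IH[of "x + a j" "y - a j"] insert.prems
  show ?case
    unfolding rademacher_tail_insert[OF insert.hyps(1,2)] by (simp add: field_simps)
qed

lemma rademacher_tail_le_half:
  assumes "finite A" "x > 0"
  shows "rademacher_tail A a x \<le> 1/2"
  using rademacher_tail_add_le_1[of A x x a] assms by simp

section \<open>The simple random walk\<close>

definition walk_tail :: "nat \<Rightarrow> real \<Rightarrow> real" where
  "walk_tail m x = measure_pmf.prob (rademacher_sum_pmf m) {w. w \<ge> x}"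

lemma walk_tail_eq_rademacher_tail: "walk_tail m x = rademacher_tail {1..m} (\<lambda>_. 1) x"
  by (simp add: walk_tail_def rademacher_sum_pmf_def rademacher_tail_def)

lemma walk_tail_nonneg: "0 \<le> walk_tail m x"
  by (simp add: walk_tail_def)

lemma walk_tail_0: "walk_tail 0 x = (if x \<le> 0 then 1 else 0)"
  by (simp add: walk_tail_eq_rademacher_tail rademacher_tail_empty)

lemma walk_tail_Suc: "walk_tail (Suc m) x = (walk_tail m (x - 1) + walk_tail m (x + 1)) / 2"
proof -
  have "{1..Suc m} = insert (Suc m) {1..m}" by auto
  then show ?thesis
    by (simp add: walk_tail_eq_rademacher_tail rademacher_tail_insert)
qed

lemma walk_tail_antimono: "x \<le> y \<Longrightarrow> walk_tail m y \<le> walk_tail m x"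
  unfolding walk_tail_def by (intro measure_pmf.finite_measure_mono) auto

text \<open>The position after \<open>m\<close> steps has the parity of \<open>m\<close>, so it cannot equal a \<open>k\<close> of the other parity.\<close>
lemma walk_tail_parity:
  assumes "odd (int m + k)"
  shows "walk_tail m (of_int k) = walk_tail m (of_int (k + 1))"
  using assms
proof (induction m arbitrary: k)
  case 0
  then have "k \<noteq> 0" by auto
  then show ?case by (auto simp: walk_tail_0)
next
  case (Suc m)
  from Suc.IH[of "k - 1"] Suc.IH[of "k + 1"] Suc.prems show ?case
    by (simp add: walk_tail_Suc algebra_simps)
qed

text \<open>By symmetry, \<open>W\<^sub>m \<ge> 1 - k\<close> has the probability of \<open>W\<^sub>m \<le> k - 1\<close>, which for an integer-valued
  variable is the event complementary to \<open>W\<^sub>m \<ge> k\<close>.\<close>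
lemma walk_tail_complement: "walk_tail m (of_int k) + walk_tail m (1 - of_int k) = 1"
proof (induction m arbitrary: k)
  case 0
  have "real_of_int k \<le> 0 \<longleftrightarrow> \<not> 1 - real_of_int k \<le> 0"
    by (simp add: not_le) linarith
  then show ?case by (auto simp: walk_tail_0)
next
  case (Suc m)
  from Suc.IH[of "k - 1"] Suc.IH[of "k + 1"] show ?case
    by (simp add: walk_tail_Suc field_simps)
qed

lemma walk_tail_odd_1:
  assumes "odd m"
  shows "walk_tail m 1 = 1/2"
  using walk_tail_parity[of m 0] walk_tail_complement[of m 0] assms by simp

section \<open>Fixed coefficients\<close>

text \<open>The number of steps of the comparison walk: \<open>n\<close>, or \<open>n - 1\<close> if parity forbids
  \<open>W\<^sub>n\<close> the value \<open>k\<close>.\<close>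
definition walk_steps :: "nat \<Rightarrow> nat \<Rightarrow> nat" where
  "walk_steps n k = (if even (n + k) then n else n - 1)"

text \<open>The case \<open>n = 0\<close> is separate because in its odd case truncated subtraction breaks the
  recursion; the walks then have no steps
  and reach none of the positive levels \<open>k - 1\<close>, \<open>k\<close>, \<open>k + 1\<close>.\<close>
lemma walk_bound_recursion:
  assumes "k \<ge> 2"
  shows "(walk_tail (walk_steps n (k - 1)) (real (k - 1)) +
      walk_tail (walk_steps n (k + 1)) (real (k + 1))) / 2 \<le>
    walk_tail (walk_steps (Suc n) k) (real k)"
proof -
  from assms have same: "walk_steps n (k - 1) = walk_steps n (k + 1)"
    by (simp add: walk_steps_def)
  show ?thesis
  proof (cases "n = 0 \<and> odd (Suc n + k)")
    case True
    with assms same show ?thesis by (simp add: walk_steps_def walk_tail_0 walk_tail_nonneg)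
  next
    case False
    then have "walk_steps (Suc n) k = Suc (walk_steps n (k + 1))"
      by (auto simp: walk_steps_def)
    with assms same show ?thesis by (simp add: walk_tail_Suc add.commute of_nat_diff)
  qed
qed

text \<open>The hypothesis \<open>real k - 1 < x\<close>, in place of \<open>k = \<lceil>x\<rceil>\<close>, survives the rescaling, which
  can only raise \<open>x\<close>.\<close>
lemma rademacher_tail_le_bound:
  assumes "finite A" "\<And>i. i \<in> A \<Longrightarrow> \<bar>a i\<bar> \<le> 1" "k \<ge> 1" "real k - 1 < x"
  shows "rademacher_tail A a x \<le> walk_tail (walk_steps (card A) k) (real k)"
  using assms
proof (induction "card A" arbitrary: A a k x)
  case 0
  then show ?case
    by (simp add: rademacher_tail_empty walk_tail_nonneg)
next
  case (Suc n)
  show ?case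
  proof (cases "k = 1 \<or> (\<forall>i\<in>A. a i = 0)")
    case True
    then show ?thesis
    proof
      assume k: "k = 1"
      then have "odd (walk_steps (card A) k)"
        using Suc.hyps(2)[symmetric] by (auto simp: walk_steps_def)
      then show ?thesis
        using k Suc.prems rademacher_tail_le_half[of A x a] by (simp add: walk_tail_odd_1)
    next
      assume "\<forall>i\<in>A. a i = 0"
      then have "rademacher_tail A a x = 0"
        using Suc.prems by (simp add: rademacher_tail_def)
      then show ?thesis
        by (simp add: walk_tail_nonneg)
    qed
  next
    case False
    then have k: "k \<ge> 2" using Suc.prems by auto
    have ne: "A \<noteq> {}" using Suc.hyps(2) by auto
    \<comment> \<open>Dividing by the largest modulus produces a coefficient of modulus 1.\<close>
    define c where "c = Max ((\<lambda>i. \<bar>a i\<bar>) ` A)"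
    have le_c: "\<bar>a i\<bar> \<le> c" if "i \<in> A" for i
      using that Suc.prems(1) by (simp add: c_def)
    have "c \<in> (\<lambda>i. \<bar>a i\<bar>) ` A"
      unfolding c_def using Suc.prems(1) ne by (intro Max_in) auto
    then obtain j where j: "j \<in> A" "c = \<bar>a j\<bar>" by auto
    from False obtain i where "i \<in> A" "a i \<noteq> 0" by auto
    then have c_pos: "c > 0" using le_c[of i] by linarith
    have c_le: "c \<le> 1" using Suc.prems(2) j by simp
    define b where "b i = inverse c * a i" for i
    define y where "y = inverse c * x"
    have "x \<ge> 0" using Suc.prems k by simp
    then have "1 * x \<le> y"
      unfolding y_def using c_pos c_le by (intro mult_right_mono) (auto simp: one_le_inverse)
    then have y: "real k - 1 < y" using Suc.prems(4) by simp
    have b: "\<bar>b i\<bar> \<le> 1" if "i \<in> A" for i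
      using le_c[OF that] c_pos by (simp add: b_def abs_mult field_simps)
    have bj: "\<bar>b j\<bar> = 1"
      using c_pos j by (simp add: b_def abs_mult)
    define B where "B = A - {j}"
    have B: "finite B" "j \<notin> B" "A = insert j B" "n = card B"
      using Suc.prems(1) Suc.hyps(2) j by (auto simp: B_def)
    have "rademacher_tail A a x = rademacher_tail A b y"
      unfolding b_def y_def using c_pos by (simp add: rademacher_tail_scale)
    also have "\<dots> = (rademacher_tail B b (y - 1) + rademacher_tail B b (y + 1)) / 2"
      unfolding B(3) rademacher_tail_insert[OF B(1,2)] using bj by (auto simp: abs_if split: if_splits)
    also have "\<dots> \<le> (walk_tail (walk_steps n (k - 1)) (real (k - 1)) +
        walk_tail (walk_steps n (k + 1)) (real (k + 1))) / 2"
    proof -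
      have "rademacher_tail B b (y - 1) \<le> walk_tail (walk_steps (card B) (k - 1)) (real (k - 1))"
        using b B k y by (intro Suc.hyps(1)) (auto simp: of_nat_diff)
      moreover have
        "rademacher_tail B b (y + 1) \<le> walk_tail (walk_steps (card B) (k + 1)) (real (k + 1))"
        using b B k y by (intro Suc.hyps(1)) auto
      ultimately show ?thesis using B(4) by simp
    qed
    also have "\<dots> \<le> walk_tail (walk_steps (Suc n) k) (real k)"
      using k by (rule walk_bound_recursion)
    finally show ?thesis using Suc.hyps(2) by simp
  qed
qed

section \<open>Symmetrization\<close>

text \<open>A finite family of independent variables has a joint law determined by the marginal laws,
  and symmetry says that the marginal laws ignore a change of sign.\<close>
lemma (in prob_space) sign_flip_prob:
  fixes X :: "'i \<Rightarrow> 'a \<Rightarrow> real"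
  assumes "finite I" "I \<noteq> {}" "indep_vars (\<lambda>_. borel) X I"
    and "\<And>i. i \<in> I \<Longrightarrow> symmetric_rv M (X i)"
    and e: "\<And>i. i \<in> I \<Longrightarrow> e i \<in> {-1, 1 :: real}"
  shows "prob {\<omega>\<in>space M. x \<le> (\<Sum>i\<in>I. X i \<omega> * e i)} = prob {\<omega>\<in>space M. x \<le> (\<Sum>i\<in>I. X i \<omega>)}"
proof -
  define P where "P = PiM I (\<lambda>_. borel :: real measure)"
  define Y where "Y i \<omega> = X i \<omega> * e i" for i \<omega>
  define S where "S = {f \<in> space P. x \<le> (\<Sum>i\<in>I. f i)}"
  have X[measurable]: "X i \<in> borel_measurable M" if "i \<in> I" for i
    using assms(4)[OF that] by (simp add: symmetric_rv_def)
  have Y[measurable]: "Y i \<in> borel_measurable M" if "i \<in> I" for i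
    unfolding Y_def using X[OF that] by simp
  have S: "S \<in> sets P" unfolding S_def P_def by measurable
  have indep_Y: "indep_vars (\<lambda>_. borel) Y I"
    unfolding Y_def by (rule indep_vars_compose2[OF assms(3)]) simp
  have law: "distr M borel (Y i) = distr M borel (X i)" if "i \<in> I" for i
    using e[OF that] assms(4)[OF that] unfolding symmetric_rv_def Y_def by auto
  have joint: "prob {\<omega>\<in>space M. x \<le> (\<Sum>i\<in>I. Z i \<omega>)} =
      measure (PiM I (\<lambda>i. distr M borel (Z i))) S"
    if Z: "indep_vars (\<lambda>_. borel) Z I" "\<And>i. i \<in> I \<Longrightarrow> Z i \<in> borel_measurable M" for Z
  proof -
    have "PiM I (\<lambda>i. distr M borel (Z i)) = distr M P (\<lambda>\<omega>. \<lambda>i\<in>I. Z i \<omega>)"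
      using indep_vars_iff_distr_eq_PiM'[where I = I and M' = "\<lambda>_. borel :: real measure" and X = Z] Z assms(2) by (simp add: P_def)
    moreover have "(\<lambda>\<omega>. \<lambda>i\<in>I. Z i \<omega>) \<in> measurable M P"
      unfolding P_def by (intro measurable_restrict Z)
    moreover have "(\<lambda>\<omega>. \<lambda>i\<in>I. Z i \<omega>) -` S \<inter> space M = {\<omega>\<in>space M. x \<le> (\<Sum>i\<in>I. Z i \<omega>)}"
      by (auto simp: S_def P_def space_PiM)
    ultimately show ?thesis using S by (simp add: measure_distr)
  qed
  have "PiM I (\<lambda>i. distr M borel (Y i)) = PiM I (\<lambda>i. distr M borel (X i))"
    by (intro PiM_cong law) auto
  then show ?thesis
    using joint[OF indep_Y Y] joint[OF assms(3) X] by (simp add: Y_def)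
qed

text \<open>Average \<open>sign_flip_prob\<close> over the finitely many sign patterns, weighted by their probabilities,
  and move the finite sum inside the expectation.\<close>
lemma (in prob_space) prob_sum_eq_expectation_rademacher_tail:
  fixes X :: "'i \<Rightarrow> 'a \<Rightarrow> real"
  assumes "finite I" "I \<noteq> {}" "indep_vars (\<lambda>_. borel) X I"
    and "\<And>i. i \<in> I \<Longrightarrow> symmetric_rv M (X i)"
  shows "integrable M (\<lambda>\<omega>. rademacher_tail I (\<lambda>i. X i \<omega>) x)"
    and "prob {\<omega>\<in>space M. x \<le> (\<Sum>i\<in>I. X i \<omega>)} =
      expectation (\<lambda>\<omega>. rademacher_tail I (\<lambda>i. X i \<omega>) x)"
proof -
  define Q where "Q = Pi_pmf I (0 :: real) (\<lambda>_. rademacher_pmf)"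
  define E where "E e = {\<omega>\<in>space M. x \<le> (\<Sum>i\<in>I. X i \<omega> * e i)}" for e :: "'i \<Rightarrow> real"
  have X[measurable]: "X i \<in> borel_measurable M" if "i \<in> I" for i
    using assms(4)[OF that] by (simp add: symmetric_rv_def)
  have E[measurable]: "E e \<in> events" for e
    unfolding E_def by measurable
  have Q: "set_pmf Q = PiE_dflt I 0 (\<lambda>_. {-1, 1})"
    using assms(1) by (simp add: Q_def set_Pi_pmf rademacher_pmf_def comp_def)
  have fin: "finite (set_pmf Q)"
    unfolding Q using assms(1) by auto
  have tail: "rademacher_tail I (\<lambda>i. X i \<omega>) x = (\<Sum>e\<in>set_pmf Q. pmf Q e * indicator (E e) \<omega>)"
    if "\<omega> \<in> space M" for \<omega>
  proof -
    have "rademacher_tail I (\<lambda>i. X i \<omega>) x =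
        measure_pmf.expectation Q (indicator {e. x \<le> (\<Sum>i\<in>I. X i \<omega> * e i)})"
      by (simp add: rademacher_tail_def Q_def)
    also have "\<dots> = (\<Sum>e\<in>set_pmf Q. pmf Q e * indicator {e. x \<le> (\<Sum>i\<in>I. X i \<omega> * e i)} e)"
      using fin by (subst integral_measure_pmf[of "set_pmf Q"]) auto
    also have "\<dots> = (\<Sum>e\<in>set_pmf Q. pmf Q e * indicator (E e) \<omega>)"
      using that by (intro sum.cong) (auto simp: E_def indicator_def)
    finally show ?thesis .
  qed
  have int: "integrable M (\<lambda>\<omega>. \<Sum>e\<in>set_pmf Q. pmf Q e * indicator (E e) \<omega>)"
    by (intro Bochner_Integration.integrable_sum integrable_mult_right integrable_real_indicator)
       (auto simp: emeasure_eq_measure)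
  then show "integrable M (\<lambda>\<omega>. rademacher_tail I (\<lambda>i. X i \<omega>) x)"
    by (subst Bochner_Integration.integrable_cong[OF refl tail])
  have flip: "prob (E e) = prob {\<omega>\<in>space M. x \<le> (\<Sum>i\<in>I. X i \<omega>)}" if "e \<in> set_pmf Q" for e
    unfolding E_def using that by (intro sign_flip_prob assms) (auto simp: Q PiE_dflt_def)
  have "expectation (\<lambda>\<omega>. rademacher_tail I (\<lambda>i. X i \<omega>) x) =
      expectation (\<lambda>\<omega>. \<Sum>e\<in>set_pmf Q. pmf Q e * indicator (E e) \<omega>)"
    by (rule Bochner_Integration.integral_cong[OF refl tail])
  also have "\<dots> = (\<Sum>e\<in>set_pmf Q. pmf Q e * prob (E e))"
    by (subst Bochner_Integration.integral_sum)
       (auto intro!: integrable_mult_right integrable_real_indicator simp: emeasure_eq_measure)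
  also have "\<dots> = (\<Sum>e\<in>set_pmf Q. pmf Q e) * prob {\<omega>\<in>space M. x \<le> (\<Sum>i\<in>I. X i \<omega>)}"
    using flip by (simp add: sum_distrib_right)
  also have "(\<Sum>e\<in>set_pmf Q. pmf Q e) = 1"
    using fin by (intro sum_pmf_eq_1) auto
  finally show "prob {\<omega>\<in>space M. x \<le> (\<Sum>i\<in>I. X i \<omega>)} =
      expectation (\<lambda>\<omega>. rademacher_tail I (\<lambda>i. X i \<omega>) x)"
    by simp
qed

section \<open>The tail bound\<close>

theorem theorem1p1:
  fixes M :: "'a measure" and X :: "nat \<Rightarrow> 'a \<Rightarrow> real" and n :: nat and x :: real
  assumes "prob_space M"
    and "n \<ge> 1"
    and "prob_space.indep_vars M (\<lambda>_. borel) X {1..n}"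
    and "\<And>i. i \<in> {1..n} \<Longrightarrow> symmetric_rv M (X i)"
    and "\<And>i. i \<in> {1..n} \<Longrightarrow> AE \<omega> in M. \<bar>X i \<omega>\<bar> \<le> 1"
    and "x > 0"
  shows "\<P>(\<omega> in M. (\<Sum>i=1..n. X i \<omega>) \<ge> x) \<le>
    (if even (\<lceil>x\<rceil> + int n)
     then \<P>(w in measure_pmf (rademacher_sum_pmf n). w \<ge> x)
     else \<P>(w in measure_pmf (rademacher_sum_pmf (n - 1)). w \<ge> x))"
proof -
  interpret prob_space M by fact
  define k where "k = nat \<lceil>x\<rceil>"
  have k: "int k = \<lceil>x\<rceil>" using assms(6) by (simp add: k_def)
  have k_pos: "k \<ge> 1" and k_less: "real k - 1 < x" and k_ge: "x \<le> real k"
    using assms(6) k by linarith+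
  have nonempty: "{1..n} \<noteq> {}" using assms(2) by simp
  have int: "integrable M (\<lambda>\<omega>. rademacher_tail {1..n} (\<lambda>i. X i \<omega>) x)"
    and average: "\<P>(\<omega> in M. (\<Sum>i=1..n. X i \<omega>) \<ge> x) =
      expectation (\<lambda>\<omega>. rademacher_tail {1..n} (\<lambda>i. X i \<omega>) x)"
    using nonempty assms(3,4) by (intro prob_sum_eq_expectation_rademacher_tail; simp)+
  have "AE \<omega> in M. \<forall>i\<in>{1..n}. \<bar>X i \<omega>\<bar> \<le> 1"
    using assms(5) by (intro AE_finite_allI) auto
  then have "AE \<omega> in M. rademacher_tail {1..n} (\<lambda>i. X i \<omega>) x \<le> walk_tail (walk_steps n k) (real k)"
  proof eventually_elim
    case (elim \<omega>)
    with k_pos k_less show ?case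
      using rademacher_tail_le_bound[of "{1..n}" "\<lambda>i. X i \<omega>" k x] by simp
  qed
  then have "\<P>(\<omega> in M. (\<Sum>i=1..n. X i \<omega>) \<ge> x) \<le> walk_tail (walk_steps n k) (real k)"
    unfolding average by (intro integral_le_const int)
  also have "\<dots> \<le> walk_tail (walk_steps n k) x"
    using k_ge by (rule walk_tail_antimono)
  also have "even (\<lceil>x\<rceil> + int n) \<longleftrightarrow> even (n + k)"
    unfolding k[symmetric] by (simp add: add.commute)
  then have "walk_tail (walk_steps n k) x =
    (if even (\<lceil>x\<rceil> + int n)
     then \<P>(w in measure_pmf (rademacher_sum_pmf n). w \<ge> x)
     else \<P>(w in measure_pmf (rademacher_sum_pmf (n - 1)). w \<ge> x))"
    by (simp add: walk_steps_def walk_tail_def)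
  finally show ?thesis .
qed

end
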